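(* Let $n\ge 1$, let $E\subseteq\{(i,j): 1\le i\le j\le n\}$ be an index set containing at least one diagonal pair $(i,i)$, and let $A$ be an $E$-matrix with identifying vector $\mathbf{a}\in\mathbb{R}^{E}$, all of whose given entries are nonnegative and all of whose given diagonal entries are strictly positive. Suppose that the maximum principal submatrix of $A$ is CP-completable. Then there exists a sequence $\{A_k\}_{k\ge 1}$ of CP-completable $E$-matrices whose identifying vectors converge to $\mathbf{a}$ in $\mathbb{R}^{E}$ as $k\to\infty$.
   Context: A real symmetric $m\times m$ matrix $C$ is completely positive (a CP-matrix) if $C=BB^T$ for some entrywise nonnegative matrix $B$ (with $m$ rows and any finite number of columns); equivalently, $C=u_1u_1^T+\cdots+u_su_s^T$ for finitely many entrywise nonnegative vectors $u_1,\dots,u_s\in\mathbb{R}^m$. Given an index set $E\subseteq\{(i,j):1\le i\le j\le n\}$, an $E$-matrix $A$ is a partial symmetric $n\times n$ matrix whose entries $A_{ij}=A_{ji}$ are given real numbers for $(i,j)\in E$ and are missing for $(i,j)\notin E$ ($i\le j$). Its identifying vector is $\mathbf{a}=(A_{ij})_{(i,j)\in E}\in\mathbb{R}^E$, where $\mathbb{R}^E$ is the space of real vectors indexed by the pairs in $E$. The $E$-matrix $A$ is CP-completable if there is a completely positive $n\times n$ matrix $C$ with $C_{ij}=A_{ij}$ for all $(i,j)\in E$. Maximum principal submatrix: let $(i_1,i_1),\dots,(i_r,i_r)$ ($r\ge 1$) be all the diagonal pairs contained in $E$, and let $\hat E=\{(i,j)\in E: i,j\in\{i_1,\dots,i_r\}\}$.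 The maximum principal submatrix of $A$ is the partial symmetric $r\times r$ matrix $P$ with rows and columns indexed by $\{i_1,\dots,i_r\}$ whose given entries are $P_{ij}=A_{ij}$ for $(i,j)\in\hat E$, all other entries (up to symmetry) being missing. $P$ is CP-completable if there is a completely positive matrix with rows and columns indexed by $\{i_1,\dots,i_r\}$ that agrees with $P$ at all positions in $\hat E$. *)

theory Defs
  imports "HOL-Analysis.Function_Topology"
begin

text \<open>
  A matrix with rows and columns indexed by a set \<open>I\<close> is a function of two indices; only its
  values on \<open>I \<times> I\<close> matter. The equation below is \<open>C = B B\<^sup>T\<close>, with \<open>s\<close> the number of columns
  of \<open>B\<close>; it forces \<open>C\<close> to be symmetric on \<open>I\<close>.
\<close>

definition completely_positive :: "'i set \<Rightarrow> ('i \<Rightarrow> 'i \<Rightarrow> real) \<Rightarrow> bool" where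
  "completely_positive I C \<longleftrightarrow>
     (\<exists>(s::nat) B. (\<forall>i\<in>I. \<forall>k<s. 0 \<le> B i k) \<and>
        (\<forall>i\<in>I. \<forall>j\<in>I. C i j = (\<Sum>k<s. B i k * B j k)))"

text \<open>In a partial matrix, \<^const>\<open>None\<close> marks a missing entry.\<close>

type_synonym 'i partial_matrix = "'i \<Rightarrow> 'i \<Rightarrow> real option"

definition cp_completable :: "'i set \<Rightarrow> 'i partial_matrix \<Rightarrow> bool" where
  "cp_completable I P \<longleftrightarrow>
     (\<exists>C. completely_positive I C \<and> (\<forall>i\<in>I. \<forall>j\<in>I. \<forall>x. P i j = Some x \<longrightarrow> C i j = x))"

definition upper_pairs :: "nat \<Rightarrow> (nat \<times> nat) set" where
  "upper_pairs n = {(i, j). 1 \<le> i \<and> i \<le> j \<and> j \<le> n}"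

text \<open>
  For \<open>E \<subseteq> upper_pairs n\<close>, these are the partial symmetric \<open>n \<times> n\<close> matrices whose given entries
  are, up to symmetry, exactly those at the positions in \<open>E\<close>; everything outside \<open>{1..n}\<close> is
  missing.
\<close>

definition E_matrix :: "(nat \<times> nat) set \<Rightarrow> nat partial_matrix \<Rightarrow> bool" where
  "E_matrix E A \<longleftrightarrow>
     (\<forall>i j. A i j = A j i) \<and> (\<forall>i j. i \<le> j \<longrightarrow> (A i j \<noteq> None \<longleftrightarrow> (i, j) \<in> E))"

text \<open>
  The space \<open>\<real>\<^sup>E\<close> is represented by the extensional functions on \<open>E\<close>, that is, by the carrier of
  \<open>powertop_real E\<close>, whose topology is the Euclidean one because \<open>E\<close> is finite.
\<close>

definition identifying_vector :: "(nat \<times> nat) set \<Rightarrow> nat partial_matrix \<Rightarrow> nat \<times> nat \<Rightarrow> real" where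
  "identifying_vector E A = (\<lambda>(i, j)\<in>E. the (A i j))"

definition diagonal_indices :: "(nat \<times> nat) set \<Rightarrow> nat set" where
  "diagonal_indices E = {i. (i, i) \<in> E}"

text \<open>
  The maximum principal submatrix keeps its original row and column labels
  \<open>diagonal_indices E\<close> instead of being renumbered to \<open>{1..r}\<close>.
\<close>

definition max_principal_submatrix :: "(nat \<times> nat) set \<Rightarrow> nat partial_matrix \<Rightarrow> nat partial_matrix"
  where
  "max_principal_submatrix E A = (\<lambda>i j.
     if i \<in> diagonal_indices E \<and> j \<in> diagonal_indices E then A i j else None)"

end

theory Submission
  imports Defs
begin

text \<open>
  Let \<open>D\<close> be the set of indices with a given diagonal entry. Extend a completion of the maximum
  principal submatrix by zeros, and for each given entry \<open>a\<close> at a position \<open>(p, q)\<close> outside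
  \<open>D \<times> D\<close> add the rank-one matrix \<open>u u\<^sup>T\<close> with \<open>u = x e\<^sub>p + (a / x) e\<^sub>q\<close>. This puts \<open>a\<close> at the
  position \<open>(p, q)\<close> and changes otherwise only the diagonal entries at \<open>p\<close> and \<open>q\<close>, at most one
  of which is given. Letting \<open>x \<rightarrow> 0\<close> if \<open>p \<in> D\<close> and \<open>x \<rightarrow> \<infinity>\<close> if not makes the change of
  the given diagonal entry vanish in the limit.
\<close>

text \<open>Place the two factors side by side:
  \<open>[B B'] [B B']\<^sup>T = B B\<^sup>T + B' B'\<^sup>T\<close>.\<close>

lemma completely_positive_add:
  assumes "completely_positive I C" and "completely_positive I C'"
  shows "completely_positive I (\<lambda>i j. C i j + C' i j)"
proof -
  obtain s :: nat and B where B: "\<forall>i\<in>I. \<forall>k<s. 0 \<le> B i k"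
    "\<forall>i\<in>I. \<forall>j\<in>I. C i j = (\<Sum>k<s. B i k * B j k)"
    using assms(1) unfolding completely_positive_def by blast
  obtain s' :: nat and B' where B': "\<forall>i\<in>I. \<forall>k<s'. 0 \<le> B' i k"
    "\<forall>i\<in>I. \<forall>j\<in>I. C' i j = (\<Sum>k<s'. B' i k * B' j k)"
    using assms(2) unfolding completely_positive_def by blast
  define G where "G = (\<lambda>i k. if k < s then B i k else B' i (k - s))"
  have "(\<Sum>k<s + s'. G i k * G j k) = (\<Sum>k<s. B i k * B j k) + (\<Sum>k<s'. B' i k * B' j k)"
    for i j
  proof -
    have "(\<Sum>k<s + s'. G i k * G j k)
        = (\<Sum>k<s. G i k * G j k) + (\<Sum>k<s'. G i (s + k) * G j (s + k))"
      by (induction s') (simp_all add: add.assoc)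
    then show ?thesis
      by (simp add: G_def)
  qed
  moreover have "\<forall>i\<in>I. \<forall>k<s + s'. 0 \<le> G i k"
    using B(1) B'(1) by (auto simp: G_def)
  ultimately show ?thesis
    unfolding completely_positive_def using B(2) B'(2)
    by (intro exI[of _ "s + s'"] exI[of _ G]) auto
qed

lemma completely_positive_zero: "completely_positive I (\<lambda>i j. 0)"
  unfolding completely_positive_def by (intro exI[of _ 0]) simp

lemma completely_positive_rank_one:
  assumes "\<And>i. i \<in> I \<Longrightarrow> 0 \<le> u i"
  shows "completely_positive I (\<lambda>i j. u i * u j)"
  unfolding completely_positive_def using assms
  by (intro exI[of _ 1] exI[of _ "\<lambda>i k. u i"]) simp

lemma completely_positive_sum:
  assumes "\<And>f. f \<in> F \<Longrightarrow> completely_positive I (C f)"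
  shows "completely_positive I (\<lambda>i j. \<Sum>f\<in>F. C f i j)"
  using assms
  by (induction F rule: infinite_finite_induct)
    (simp_all add: completely_positive_zero completely_positive_add)

lemma completely_positive_extend_zero:
  assumes "completely_positive J C"
  shows "completely_positive I (\<lambda>i j. if i \<in> J \<and> j \<in> J then C i j else 0)"
proof -
  obtain s :: nat and B where B: "\<forall>i\<in>J. \<forall>k<s. 0 \<le> B i k"
    "\<forall>i\<in>J. \<forall>j\<in>J. C i j = (\<Sum>k<s. B i k * B j k)"
    using assms unfolding completely_positive_def by blast
  then show ?thesis
    unfolding completely_positive_def
    by (intro exI[of _ s] exI[of _ "\<lambda>i k. if i \<in> J then B i k else 0"]) auto
qed

lemma completely_positive_sym:
  assumes "completely_positive I C" "i \<in> I" "j \<in> I"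
  shows "C i j = C j i"
  using assms unfolding completely_positive_def by (auto simp: mult.commute)

definition edge_vector :: "'i \<Rightarrow> 'i \<Rightarrow> real \<Rightarrow> real \<Rightarrow> 'i \<Rightarrow> real" where
  "edge_vector p q a x i = (if i = p then x else 0) + (if i = q then a / x else 0)"

text \<open>The value \<open>x = 0\<close> is allowed because \<open>a / 0 = 0\<close>; it occurs at
  \<open>k = 0\<close> for both scalings used below.\<close>

lemma edge_vector_nonneg: "0 \<le> a \<Longrightarrow> 0 \<le> x \<Longrightarrow> 0 \<le> edge_vector p q a x i"
  by (simp add: edge_vector_def)

text \<open>For \<open>x \<noteq> 0\<close> the product is \<open>a\<close> at
  \<open>(p, q)\<close>, \<open>x^2\<close> at \<open>(p, p)\<close>, \<open>(a / x)^2\<close> at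
  \<open>(q, q)\<close>, and 0 at every other \<open>(i, j)\<close> with \<open>i \<le> j\<close>.
  Diagonal positions are tested only in \<open>D\<close>, so at most one of the two squares matters,
  and \<open>x\<close> is chosen to make that one vanish.\<close>

lemma edge_vector_product_tendsto:
  fixes p q i j :: nat
  assumes "p < q" and "i \<le> j" and "i = j \<Longrightarrow> i \<in> D" and "\<not> (p \<in> D \<and> q \<in> D)"
  defines "x \<equiv> \<lambda>k::nat. if p \<in> D then 1 / real k else real k"
  shows "(\<lambda>k. edge_vector p q a (x k) i * edge_vector p q a (x k) j)
           \<longlonglongrightarrow> (if (p, q) = (i, j) then a else 0)"
proof -
  have inv: "(\<lambda>k. c / real k) \<longlonglongrightarrow> 0" for c :: real
    by (rule lim_const_over_n)
  consider "p = i" "q = j" | "i = p" "j = p" | "i = q" "j = q"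
    | "i \<notin> {p, q} \<or> j \<notin> {p, q}"
    using assms(1,2) by force
  then show ?thesis
  proof cases
    case 1
    \<comment> \<open>The index \<open>k = 0\<close> must be skipped: there \<open>x k = 0\<close>,
      so the product is 0.\<close>
    have "\<forall>\<^sub>F k in sequentially. edge_vector p q a (x k) i * edge_vector p q a (x k) j = a"
      using eventually_gt_at_top[of 0]
      by eventually_elim (use 1 assms(1) in \<open>auto simp: edge_vector_def x_def\<close>)
    then show ?thesis
      using 1 by (simp add: tendsto_eventually)
  next
    case 2
    then show ?thesis
      using assms(1,3) tendsto_mult[OF inv[of 1] inv[of 1]]
      by (simp add: edge_vector_def x_def)
  next
    case 3
    \<comment> \<open>Here \<open>q \<in> D\<close>, hence \<open>p \<notin> D\<close> and
      \<open>x k = k\<close>.\<close>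
    then show ?thesis
      using assms(1,3,4) tendsto_mult[OF inv[of a] inv[of a]]
      by (simp add: edge_vector_def x_def)
  next
    case 4
    then have "(\<lambda>k. edge_vector p q a (x k) i * edge_vector p q a (x k) j) = (\<lambda>k. 0)"
      by (auto simp: edge_vector_def)
    moreover have "(p, q) \<noteq> (i, j)"
      using 4 by auto
    ultimately show ?thesis
      by auto
  qed
qed

theorem theorem3p5:
  fixes n :: nat and E :: "(nat \<times> nat) set" and A :: "nat partial_matrix"
  assumes "n \<ge> 1"
    and "E \<subseteq> upper_pairs n"
    and "\<exists>i. (i, i) \<in> E"
    and "E_matrix E A"
    and "\<forall>e\<in>E. identifying_vector E A e \<ge> 0"
    and "\<forall>i. (i, i) \<in> E \<longrightarrow> identifying_vector E A (i, i) > 0"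
    and "cp_completable (diagonal_indices E) (max_principal_submatrix E A)"
  shows "\<exists>A' :: nat \<Rightarrow> nat partial_matrix.
           (\<forall>k\<ge>1. E_matrix E (A' k) \<and> cp_completable {1..n} (A' k)) \<and>
           limitin (powertop_real E) (\<lambda>k. identifying_vector E (A' k))
             (identifying_vector E A) sequentially"
proof -
  define D where "D = diagonal_indices E"
  define a where "a = (\<lambda>(p, q). the (A p q))"
  define F where "F = {(p, q) \<in> E. \<not> (p \<in> D \<and> q \<in> D)}"
  define u where "u = (\<lambda>k (p, q). edge_vector p q (a (p, q))
    (if p \<in> D then 1 / real k else real k))"
  obtain C where C: "completely_positive D C"
    and CA: "\<And>i j y. i \<in> D \<Longrightarrow> j \<in> D \<Longrightarrow> A i j = Some y \<Longrightarrow> C i j = y"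
    using assms(7) unfolding cp_completable_def max_principal_submatrix_def D_def by auto
  define C\<^sub>0 where "C\<^sub>0 = (\<lambda>i j. if i \<in> D \<and> j \<in> D then C i j else 0)"
  define M where "M = (\<lambda>k i j. C\<^sub>0 i j + (\<Sum>e\<in>F. u k e i * u k e j))"
  \<comment> \<open>Keeping the pattern of given entries of \<open>A\<close> and taking the values
    from \<open>M k\<close> makes \<open>M k\<close> a completion of \<open>A' k\<close>.\<close>
  define A' where "A' = (\<lambda>k i j. map_option (\<lambda>_. M k i j) (A i j))"
  have FE: "F \<subseteq> E"
    by (auto simp: F_def)
  have "upper_pairs n \<subseteq> {1..n} \<times> {1..n}"
    by (auto simp: upper_pairs_def)
  with assms(2) FE have "finite F"
    by (meson finite_SigmaI finite_atLeastAtMost finite_subset)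
  have a_nonneg: "0 \<le> a e" if "e \<in> E" for e
    using assms(5) that by (auto simp: identifying_vector_def a_def split: prod.splits)
  have A_eq: "A i j = Some (a (i, j))" if "(i, j) \<in> E" for i j
    using assms(2,4) that by (force simp: E_matrix_def upper_pairs_def a_def)
  have M_sym: "M k i j = M k j i" for k i j
    using completely_positive_sym[OF C] by (auto simp: M_def C\<^sub>0_def mult.commute)
  have E_mat: "E_matrix E (A' k)" for k
    using assms(4) M_sym unfolding E_matrix_def A'_def by simp
  have cp: "cp_completable {1..n} (A' k)" for k
  proof -
    have "completely_positive {1..n} C\<^sub>0"
      unfolding C\<^sub>0_def by (rule completely_positive_extend_zero[OF C])
    moreover have "completely_positive {1..n} (\<lambda>i j. u k e i * u k e j)" if "e \<in> F" for e
      using a_nonneg[of e] FE that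
      by (intro completely_positive_rank_one)
        (auto simp: u_def intro!: edge_vector_nonneg split: prod.splits)
    ultimately have "completely_positive {1..n} (M k)"
      unfolding M_def by (intro completely_positive_add completely_positive_sum)
    then show ?thesis
      unfolding cp_completable_def A'_def by auto
  qed
  have lim: "(\<lambda>k. M k i j) \<longlonglongrightarrow> a (i, j)" if ij: "(i, j) \<in> E" for i j
  proof -
    have "(\<lambda>k. u k e i * u k e j) \<longlonglongrightarrow> (if e = (i, j) then a e else 0)" if e: "e \<in> F" for e
    proof -
      obtain p q where pq: "e = (p, q)"
        by (cases e)
      \<comment> \<open>If \<open>p = q\<close>, then \<open>(p, p) \<in> E\<close> would put
        \<open>p\<close> in \<open>D\<close>.\<close>
      have "p \<le> q" "p \<noteq> q" "\<not> (p \<in> D \<and> q \<in> D)"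
        using e assms(2) unfolding pq F_def
        by (auto simp: D_def diagonal_indices_def upper_pairs_def)
      moreover have "i \<le> j" "i = j \<Longrightarrow> i \<in> D"
        using ij assms(2) by (auto simp: D_def diagonal_indices_def upper_pairs_def)
      ultimately show ?thesis
        unfolding pq u_def prod.case by (intro edge_vector_product_tendsto) auto
    qed
    then have "(\<lambda>k. M k i j) \<longlonglongrightarrow> C\<^sub>0 i j + (\<Sum>e\<in>F. if e = (i, j) then a e else 0)"
      unfolding M_def by (intro tendsto_intros)
    \<comment> \<open>If \<open>(i, j) \<in> F\<close>, then \<open>C\<^sub>0 i j = 0\<close> and
      the sum collapses to \<open>a (i, j)\<close>. Otherwise \<open>i\<close> and \<open>j\<close>
      lie in \<open>D\<close>, the sum is 0, and \<open>C\<close> has the given entry.\<close>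
    also have "C\<^sub>0 i j + (\<Sum>e\<in>F. if e = (i, j) then a e else 0) = a (i, j)"
      using ij CA A_eq \<open>finite F\<close> by (auto simp: C\<^sub>0_def F_def)
    finally show ?thesis .
  qed
  have id_A': "identifying_vector E (A' k) (i, j) = M k i j" if "(i, j) \<in> E" for k i j
    using that A_eq by (simp add: identifying_vector_def A'_def)
  \<comment> \<open>Convergence in the product topology is coordinatewise; besides, the vectors must
    be extensional on \<open>E\<close>.\<close>
  have "limitin (powertop_real E) (\<lambda>k. identifying_vector E (A' k))
      (identifying_vector E A) sequentially"
    unfolding limitin_componentwise
  proof (intro conjI ballI)
    show "limitin euclideanreal (\<lambda>k. identifying_vector E (A' k) e)
        (identifying_vector E A e) sequentially" if "e \<in> E" for e
      using that lim by (cases e) (simp add: id_A', simp add: identifying_vector_def a_def)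
  qed (auto simp: identifying_vector_def)
  with E_mat cp show ?thesis
    by blast
qed

end
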